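(* There are no bi-unitary harmonic numbers of the form $p^3q^2$, where $p$ and $q$ are distinct primes.
   Context: A divisor $d$ of $n$ is a unitary divisor if $\gcd(d,n/d)=1$; a divisor $d$ of $n$ is a bi-unitary divisor if the greatest common unitary divisor of $d$ and $n/d$ is $1$. $\sigma^{**}(n)$ denotes the sum and $d^{**}(n)$ the number of bi-unitary divisors of $n$. $n$ is bi-unitary harmonic if $\sigma^{**}(n)\mid n\,d^{**}(n)$. *)

theory Defs
  imports "HOL-Computational_Algebra.Primes"
begin

definition unitary_divisor :: "nat \<Rightarrow> nat \<Rightarrow> bool" where
  "unitary_divisor d n \<longleftrightarrow> d dvd n \<and> gcd d (n div d) = 1"

(* The set below always contains 1 and is finite, so Max is meaningful. *)
definition greatest_common_unitary_divisor :: "nat \<Rightarrow> nat \<Rightarrow> nat" where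
  "greatest_common_unitary_divisor a b = Max {c. unitary_divisor c a \<and> unitary_divisor c b}"

definition bi_unitary_divisor :: "nat \<Rightarrow> nat \<Rightarrow> bool" where
  "bi_unitary_divisor d n \<longleftrightarrow> d dvd n \<and> greatest_common_unitary_divisor d (n div d) = 1"

(* For n = 0 the set of bi-unitary divisors is infinite; the two functions
   below carry their intended meaning for n > 0 only. *)
definition bi_unitary_sigma :: "nat \<Rightarrow> nat" where
  "bi_unitary_sigma n = (\<Sum>d | bi_unitary_divisor d n. d)"

definition bi_unitary_divisor_count :: "nat \<Rightarrow> nat" where
  "bi_unitary_divisor_count n = card {d. bi_unitary_divisor d n}"

definition bi_unitary_harmonic :: "nat \<Rightarrow> bool" where
  "bi_unitary_harmonic n \<longleftrightarrow> n > 0 \<and> bi_unitary_sigma n dvd n * bi_unitary_divisor_count n"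

end

(* The bi-unitary divisors of n are the divisors d for which no prime r dividing n
   has its exponent in d equal to half of its exponent in n.  Hence those of
   p^3 q^2 are p^a q^b with a in {0,1,2,3} and b in {0,2}, and harmonicity says
   (1 + p)(1 + p^2)(1 + q^2) | 8 p^3 q^2.  By coprimality,
   (1 + p)(1 + p^2) | 8 q^2 and 1 + q^2 | 8 p^3.  As 1 + p^2 does not divide 8, q divides
   1 + p^2; if q is odd it therefore does not divide 1 + p, because
   1 + p^2 = (p + 1)(p - 1) + 2.  So 1 + p | 8, which leaves p = 3 and p = 7, both
   with q = 5, but 26 does not divide 8 p^3.  If q = 2, then 5 | 8 p^3 forces p = 5,
   and 6 * 26 does not divide 32. *)
theory Submission
  imports Defs
begin

section \<open>Unitary divisors and prime exponents\<close>

lemma multiplicity_unitary_divisor: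
  assumes "unitary_divisor c a" "a > 0" "prime r" "r dvd c"
  shows "multiplicity r a = multiplicity r c"
proof -
  obtain e where e: "a = c * e"
    using assms(1) by (auto simp: unitary_divisor_def)
  have "coprime c e"
    using assms e unfolding unitary_divisor_def coprime_iff_gcd_eq_1 by auto
  \<comment> \<open>The cofactor \<open>e\<close> has no factor \<open>r\<close>, so the whole
    \<open>r\<close>-part of \<open>a\<close> lies in \<open>c\<close>.\<close>
  then have "\<not> r dvd e"
    using assms(3,4) coprime_common_divisor_nat not_prime_1 by blast
  then show ?thesis
    using assms e
    by (simp add: prime_elem_multiplicity_mult_distrib not_dvd_imp_multiplicity_0)
qed

lemma unitary_divisor_prime_power:
  assumes "a > 0" "prime r"
  shows "unitary_divisor (r ^ multiplicity r a) a"
proof -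
  have "\<not> r dvd a div r ^ multiplicity r a"
    using assms multiplicity_decompose[of a r] not_prime_unit by blast
  then have "coprime (r ^ multiplicity r a) (a div r ^ multiplicity r a)"
    using assms(2) by (simp add: prime_imp_coprime coprime_power_left_iff)
  then show ?thesis
    by (simp add: unitary_divisor_def multiplicity_dvd)
qed

text \<open>A prime factor of a common unitary divisor occurs in it with its full exponent from both
  \<open>a\<close> and \<open>b\<close>, so these exponents agree. Conversely, if a prime has the
  same positive exponent in \<open>a\<close> and \<open>b\<close>, its power to that exponent is a
  common unitary divisor above 1.\<close>

lemma greatest_common_unitary_divisor_eq_1_iff:
  assumes "a > 0" "b > 0"
  shows "greatest_common_unitary_divisor a b = 1 \<longleftrightarrow>
    (\<forall>r. prime r \<and> r dvd a \<longrightarrow> multiplicity r a \<noteq> multiplicity r b)"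
    (is "_ \<longleftrightarrow> ?R")
proof -
  let ?C = "{c. unitary_divisor c a \<and> unitary_divisor c b}"
  have sub: "?C \<subseteq> {..a}"
    using assms(1) by (auto simp: unitary_divisor_def intro: dvd_imp_le)
  have fin: "finite ?C"
    by (rule finite_subset[OF sub]) simp
  have one: "1 \<in> ?C"
    by (simp add: unitary_divisor_def)
  show ?thesis
  proof
    assume gcud: "greatest_common_unitary_divisor a b = 1"
    show ?R
    proof (intro allI impI notI)
      fix r assume r: "prime r \<and> r dvd a" and eq: "multiplicity r a = multiplicity r b"
      have "r ^ multiplicity r a \<in> ?C"
        using unitary_divisor_prime_power[of a r] unitary_divisor_prime_power[of b r] r eq assms
        by simp
      then have "r ^ multiplicity r a \<le> 1"
        using gcud fin unfolding greatest_common_unitary_divisor_def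
        by (metis Max_ge)
      moreover have "multiplicity r a > 0"
        using r assms(1) by (simp add: prime_multiplicity_gt_zero_iff)
      then have "r ^ multiplicity r a > 1"
        using r prime_gt_1_nat one_less_power by blast
      ultimately show False
        by simp
    qed
  next
    assume R: ?R
    have "c = 1" if c: "c \<in> ?C" for c
    proof (rule ccontr)
      assume "c \<noteq> 1"
      then obtain r where r: "prime r" "r dvd c"
        using prime_factor_nat by blast
      have "multiplicity r a = multiplicity r b"
        using multiplicity_unitary_divisor[of c a r] multiplicity_unitary_divisor[of c b r]
          c r assms by simp
      moreover have "r dvd a"
        using c r by (auto simp: unitary_divisor_def intro: dvd_trans)
      ultimately show False
        using R r by blast
    qed
    then have "?C = {1}"
      using one by blast
    then show "greatest_common_unitary_divisor a b = 1"
      by (simp add: greatest_common_unitary_divisor_def)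
  qed
qed

text \<open>With \<open>n = d * e\<close> the exponents of \<open>d\<close> and \<open>e\<close> add
  up to that of \<open>n\<close>, so they are equal exactly when the one in \<open>d\<close> is half
  of the one in \<open>n\<close>.\<close>

lemma bi_unitary_divisor_iff:
  assumes "n > 0"
  shows "bi_unitary_divisor d n \<longleftrightarrow>
    d dvd n \<and> (\<forall>r. prime r \<and> r dvd n \<longrightarrow> multiplicity r n \<noteq> 2 * multiplicity r d)"
proof (cases "d dvd n")
  case True
  then obtain e where e: "n = d * e"
    by blast
  have pos: "d > 0" "e > 0"
    using assms e by auto
  have mult: "multiplicity r n = multiplicity r d + multiplicity r e" if "prime r" for r
    using that pos e by (simp add: prime_elem_multiplicity_mult_distrib)
  have "(prime r \<and> r dvd d \<longrightarrow> multiplicity r d \<noteq> multiplicity r e) \<longleftrightarrow>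
      (prime r \<and> r dvd n \<longrightarrow> multiplicity r n \<noteq> 2 * multiplicity r d)" for r
  proof (cases "prime r")
    case prime: True
    \<comment> \<open>For \<open>r\<close> dividing \<open>n\<close> but not \<open>d\<close> the
      left side is vacuous, and the right side holds because it compares a positive exponent with
      0.\<close>
    have "r dvd n \<longleftrightarrow> multiplicity r n > 0" "r dvd d \<longleftrightarrow> multiplicity r d > 0"
      using prime pos assms by (simp_all add: prime_multiplicity_gt_zero_iff)
    then show ?thesis
      using mult[OF prime] by auto
  qed simp
  moreover have "n div d = e"
    using e pos by simp
  ultimately show ?thesis
    using True pos by (simp add: bi_unitary_divisor_def greatest_common_unitary_divisor_eq_1_iff
      del: One_nat_def)
qed (simp add: bi_unitary_divisor_def)

section \<open>The bi-unitary divisors of \<open>p ^ 3 * q ^ 2\<close>, their number and sum\<close>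

context
  fixes p q :: nat
  assumes primes: "prime p" "prime q" "p \<noteq> q"
begin

lemma multiplicity_prime_powers:
  "multiplicity p (p ^ a * q ^ b) = a" "multiplicity q (p ^ a * q ^ b) = b"
  using primes
  by (simp_all add: prime_elem_multiplicity_mult_distrib prime_elem_multiplicity_power_distrib
      prime_multiplicity_other)

text \<open>The exponents are recovered as multiplicities. This lets the count and the sum of the
  divisors be taken over exponent pairs.\<close>

lemma inj_prime_powers: "inj_on (\<lambda>(a, b). p ^ a * q ^ b) A"
  by (rule inj_onI) (metis (no_types, lifting) case_prod_conv multiplicity_prime_powers surj_pair)

lemma bi_unitary_divisors_p3q2:
  "{d. bi_unitary_divisor d (p ^ 3 * q ^ 2)} = (\<lambda>(a, b). p ^ a * q ^ b) ` ({..3} \<times> {0, 2})"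
proof -
  have pos: "p ^ 3 * q ^ 2 > 0"
    using primes by (simp add: prime_gt_0_nat)
  have dvd_cases: "r = p \<or> r = q" if "prime r" "r dvd p ^ 3 * q ^ 2" for r
    using that primes by (metis prime_dvd_mult_iff prime_dvd_power primes_dvd_imp_eq)
  have iff: "bi_unitary_divisor (p ^ a * q ^ b) (p ^ 3 * q ^ 2) \<longleftrightarrow> b \<noteq> 1"
    if "a \<le> 3" "b \<le> 2" for a b
  proof -
    have "p ^ a * q ^ b dvd p ^ 3 * q ^ 2"
      using that by (intro mult_dvd_mono le_imp_power_dvd)
    moreover have "p dvd p ^ 3 * q ^ 2" "q dvd p ^ 3 * q ^ 2"
      by (simp_all add: dvd_mult dvd_mult2)
    \<comment> \<open>The exponent of \<open>p\<close> is odd and has no half, so only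
      \<open>q\<close> excludes a divisor, namely when \<open>b = 1\<close>.\<close>
    moreover have "3 \<noteq> 2 * a"
      by presburger
    ultimately have "bi_unitary_divisor (p ^ a * q ^ b) (p ^ 3 * q ^ 2) \<longleftrightarrow>
        (\<forall>r \<in> {p, q}. multiplicity r (p ^ 3 * q ^ 2) \<noteq> 2 * multiplicity r (p ^ a * q ^ b))"
      using primes dvd_cases unfolding bi_unitary_divisor_iff[OF pos] by blast
    then show ?thesis
      using \<open>3 \<noteq> 2 * a\<close> by (simp add: multiplicity_prime_powers)
  qed
  show ?thesis
  proof (intro equalityI subsetI)
    fix d assume "d \<in> {d. bi_unitary_divisor d (p ^ 3 * q ^ 2)}"
    then have d: "bi_unitary_divisor d (p ^ 3 * q ^ 2)"
      by simp
    then have "d dvd p ^ 3 * q ^ 2"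
      by (simp add: bi_unitary_divisor_def)
    then obtain x y where "d = x * y" "x dvd p ^ 3" "y dvd q ^ 2"
      using division_decomp by blast
    then obtain a b where ab: "a \<le> 3" "b \<le> 2" "d = p ^ a * q ^ b"
      using primes divides_primepow_nat by metis
    then have "b \<noteq> 1"
      using d iff by blast
    then have "b = 0 \<or> b = 2"
      using ab(2) by linarith
    then show "d \<in> (\<lambda>(a, b). p ^ a * q ^ b) ` ({..3} \<times> {0, 2})"
      using ab by force
  next
    fix d assume "d \<in> (\<lambda>(a, b). p ^ a * q ^ b) ` ({..3} \<times> {0, 2})"
    then obtain a b where "a \<le> 3" "b = 0 \<or> b = 2" "d = p ^ a * q ^ b"
      by auto
    then show "d \<in> {d. bi_unitary_divisor d (p ^ 3 * q ^ 2)}"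
      using iff[of a b] by auto
  qed
qed

lemma bi_unitary_divisor_count_p3q2: "bi_unitary_divisor_count (p ^ 3 * q ^ 2) = 8"
  unfolding bi_unitary_divisor_count_def bi_unitary_divisors_p3q2
  by (subst card_image[OF inj_prime_powers]) (simp add: card_cartesian_product)

text \<open>The sum over exponent pairs is \<open>(1 + p + p ^ 2 + p ^ 3) * (1 + q ^ 2)\<close>, and
  its first factor splits as \<open>(1 + p) * (1 + p ^ 2)\<close>.\<close>

lemma bi_unitary_sigma_p3q2:
  "bi_unitary_sigma (p ^ 3 * q ^ 2) = (1 + p) * (1 + p ^ 2) * (1 + q ^ 2)"
proof -
  have "bi_unitary_sigma (p ^ 3 * q ^ 2) = (\<Sum>(a, b) \<in> {..3} \<times> {0, 2}. p ^ a * q ^ b)"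
    unfolding bi_unitary_sigma_def bi_unitary_divisors_p3q2
    by (subst sum.reindex[OF inj_prime_powers]) (simp only: case_prod_unfold o_def)
  also have "\<dots> = (\<Sum>a\<le>3. \<Sum>b\<in>{0, 2}. p ^ a * q ^ b)"
    by (rule sum.cartesian_product[symmetric])
  also have "\<dots> = (1 + p) * (1 + p ^ 2) * (1 + q ^ 2)"
    by (simp add: eval_nat_numeral algebra_simps)
  finally show ?thesis .
qed

end

section \<open>The divisibility that harmonicity would require\<close>

lemma dvd_8_cases:
  assumes "(m::nat) dvd 8"
  shows "m \<in> {1, 2, 4, 8}"
proof -
  have "m \<le> 8" "m > 0"
    using assms dvd_imp_le[of m 8] by (auto intro: Nat.gr0I)
  then have "m \<in> {1, 2, 3, 4, 5, 6, 7, 8}"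
    by auto
  then show ?thesis
    using assms by auto
qed

lemma not_sigma_dvd:
  fixes p q :: nat
  assumes primes: "prime p" "prime q"
  shows "\<not> (1 + p) * (1 + p ^ 2) * (1 + q ^ 2) dvd 8 * (p ^ 3 * q ^ 2)"
proof
  assume dvd: "(1 + p) * (1 + p ^ 2) * (1 + q ^ 2) dvd 8 * (p ^ 3 * q ^ 2)"
  have p2: "p \<ge> 2"
    using primes prime_ge_2_nat by blast
  \<comment> \<open>A common divisor of \<open>1 + x\<close> and \<open>y\<close> divides
    \<open>x\<close>, hence 1. Below, \<open>x\<close> is \<open>p\<close>, \<open>p ^ 2\<close> or
    \<open>q ^ 2\<close>.\<close>
  have cop: "coprime (1 + x) y" if "y dvd x" for x y :: nat
  proof (rule coprimeI)
    fix c assume "c dvd 1 + x" "c dvd y"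
    then show "is_unit c"
      using \<open>y dvd x\<close> dvd_add_left_iff dvd_trans by blast
  qed
  have "coprime (1 + p) p" "coprime (1 + p ^ 2) p"
    by (rule cop, simp)+
  then have "coprime ((1 + p) * (1 + p ^ 2)) (p ^ 3)"
    by (simp only: coprime_mult_left_iff coprime_power_right_iff) simp
  moreover have "(1 + p) * (1 + p ^ 2) dvd (8 * q ^ 2) * p ^ 3"
    using dvd_mult_left[OF dvd] by (simp add: mult_ac)
  ultimately have dvd_q: "(1 + p) * (1 + p ^ 2) dvd 8 * q ^ 2"
    using coprime_dvd_mult_left_iff by blast
  have "coprime (1 + q ^ 2) (q ^ 2)"
    by (rule cop) simp
  moreover have "1 + q ^ 2 dvd (8 * p ^ 3) * q ^ 2"
    using dvd_mult_right[OF dvd] by (simp add: mult_ac)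
  ultimately have dvd_p: "1 + q ^ 2 dvd 8 * p ^ 3"
    using coprime_dvd_mult_left_iff by blast
  \<comment> \<open>Used for \<open>1 + p ^ 2\<close>, to show that \<open>q\<close> divides it, and
    for \<open>1 + p\<close>, which an odd \<open>q\<close> does not divide.\<close>
  have dvd_8: "m dvd 8" if "m dvd 8 * q ^ 2" "\<not> q dvd m" for m
  proof -
    have "coprime m (q ^ 2)"
      using that(2) primes(2) prime_imp_coprime[of q m]
      by (simp add: coprime_commute)
    then show ?thesis
      using that(1) coprime_dvd_mult_left_iff by blast
  qed
  have "q dvd 1 + p ^ 2"
  proof (rule ccontr)
    assume "\<not> q dvd 1 + p ^ 2"
    then have "1 + p ^ 2 dvd 8"
      using dvd_8 dvd_mult_right[OF dvd_q] by blast
    then have 1: "1 + p ^ 2 \<in> {1, 2, 4, 8}"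
      by (rule dvd_8_cases)
    \<comment> \<open>Here \<open>p ^ 2\<close> is at most 7, which leaves only
      \<open>p = 2\<close>, but 5 is not among the divisors of 8.\<close>
    then have "p ^ 2 < 3 ^ 2"
      by auto
    then have "p = 2"
      using p2 power_less_imp_less_base[of p 2 3] by simp
    then show False
      using 1 by simp
  qed
  show False
  proof (cases "q = 2")
    case True
    then have "5 dvd 8 * p ^ 3"
      using dvd_p by simp
    moreover have "prime (5::nat)"
      by simp
    ultimately have "5 dvd p"
      using prime_dvd_mult_iff[of 5 8 "p ^ 3"] prime_dvd_power[of 5 p 3] by simp
    then have "p = 5"
      using primes primes_dvd_imp_eq[of 5 p] by simp
    then show False
      using dvd_q True by simp
  next
    case False
    have "\<not> q dvd 1 + p"
    proof
      assume "q dvd 1 + p"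
      moreover have "1 + p ^ 2 = (1 + p) * (p - 1) + 2"
        using p2 by (cases p) (simp_all add: power2_eq_square)
      ultimately have "q dvd 2"
        using \<open>q dvd 1 + p ^ 2\<close> by (metis dvd_add_right_iff dvd_mult2)
      then show False
        using False primes primes_dvd_imp_eq[of q 2] by simp
    qed
    then have "1 + p dvd 8"
      using dvd_8 dvd_mult_left[OF dvd_q] by blast
    then have "1 + p \<in> {1, 2, 4, 8}"
      by (rule dvd_8_cases)
    then have p: "p = 3 \<or> p = 7"
      using p2 by auto
    \<comment> \<open>The value of \<open>1 + p ^ 2\<close> is 10 or 50, and both divide 50, so one
      argument covers both cases.\<close>
    then have "q dvd 2 * 5 ^ 2"
      using \<open>q dvd 1 + p ^ 2\<close> by (auto intro: dvd_trans)
    then have "q dvd 2 \<or> q dvd 5"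
      using primes(2) by (meson prime_dvd_mult_iff prime_dvd_power)
    then have "q = 5"
      using False primes(2) primes_dvd_imp_eq[of q 2] primes_dvd_imp_eq[of q 5] by auto
    then show False
      \<comment> \<open>Now \<open>1 + q ^ 2\<close> is 26, and its factor 13 does not divide
        \<open>8 * p ^ 3\<close> for \<open>p = 3\<close> or \<open>p = 7\<close>.\<close>
      using p dvd_p by auto
  qed
qed

theorem theorem4:
  shows "\<not> (\<exists>n p q :: nat. prime p \<and> prime q \<and> p \<noteq> q \<and> n = p ^ 3 * q ^ 2 \<and> bi_unitary_harmonic n)"
  using not_sigma_dvd
  by (auto simp: bi_unitary_harmonic_def bi_unitary_sigma_p3q2 bi_unitary_divisor_count_p3q2
      mult.commute)

end
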